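(* Let $\mathcal{C}_3$ denote the set of integers occurring as a coordinate of some 3-color fair game, i.e. of some triple of non-negative integers $(x_1,x_2,x_3)$ with $(x_1+x_2+x_3)^2-(x_1+x_2+x_3)-4(x_1x_2+x_1x_3+x_2x_3)=0$. Then $\mathcal{C}_3$ has natural density zero, i.e. $\lim_{k\to\infty}|\{c\in\mathcal{C}_3: c\le k\}|/k=0$. *)

theory Defs
  imports Complex_Main
begin

definition fair_game3 :: "int \<Rightarrow> int \<Rightarrow> int \<Rightarrow> bool" where
  "fair_game3 x1 x2 x3 \<longleftrightarrow>
     0 \<le> x1 \<and> 0 \<le> x2 \<and> 0 \<le> x3 \<and>
     (x1 + x2 + x3)\<^sup>2 - (x1 + x2 + x3) - 4 * (x1 * x2 + x1 * x3 + x2 * x3) = 0"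

definition C3 :: "int set" where
  "C3 = {c. \<exists>x1 x2 x3. fair_game3 x1 x2 x3 \<and> c \<in> {x1, x2, x3}}"

end

theory Submission
  imports Defs "HOL-Number_Theory.Number_Theory" "HOL-Analysis.Harmonic_Numbers"
begin

text \<open>
  If \<open>(x1, x2, c)\<close> is a fair game and \<open>t = x1 - x2 + c\<close>, then
  \<open>t\<^sup>2 + t + 1 = (2c + 1)(2 x1 + 1)\<close>, so no prime \<open>p = 2 (mod 3)\<close> divides \<open>2c + 1\<close>.
  It remains to see that the product of \<open>1 - 1/p\<close> over the primes \<open>p = 2 (mod 3)\<close> up to \<open>N\<close>
  tends to 0. Let \<open>H\<close> be the harmonic sum and \<open>S\<close> the sum of \<open>1/b\<close> over those \<open>b \<le> N\<close> all of
  whose prime factors are \<open>1 (mod 3)\<close>. Sieving gives \<open>\<Prod>(1 - 1/p) H(N) \<le> S\<close>, with the product over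
  primes \<open>p \<le> N\<close> that are not \<open>1 (mod 3)\<close>. Let \<open>\<chi>\<close> be the nontrivial character mod 3 and
  \<open>r(n) = \<Sum>d|n. \<chi>(d)\<close>, which is nonnegative and counts all divisors of the \<open>n\<close> with only prime factors
  \<open>1 (mod 3)\<close>. Then \<open>S\<^sup>2 \<le> \<Sum>n\<le>N\<^sup>2. r(n)/n = \<Sum>d\<le>N\<^sup>2. \<chi>(d)/d H(N\<^sup>2/d) \<le> H(N\<^sup>2) \<le> 3 H(N)\<close>,
  the middle bound because the signs alternate and the terms decrease. So the product is
  \<open>O(H(N) powr (-1/2))\<close>.
\<close>

section \<open>The nontrivial character mod 3 and its divisor sums\<close>

definition chi :: "nat \<Rightarrow> real" where
  "chi n = (if n mod 3 = 1 then 1 else if n mod 3 = 2 then - 1 else 0)"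

lemma chi_mult: "chi (m * n) = chi m * chi n"
proof -
  have "m mod 3 = 0 \<or> m mod 3 = 1 \<or> m mod 3 = 2" "n mod 3 = 0 \<or> n mod 3 = 1 \<or> n mod 3 = 2" by arith+
  moreover have "(m * n) mod 3 = ((m mod 3) * (n mod 3)) mod 3" by (simp add: mod_mult_eq)
  ultimately show ?thesis unfolding chi_def by auto
qed

lemma chi_power: "chi (m ^ k) = chi m ^ k"
proof (induction k)
  case 0
  show ?case by (simp add: chi_def)
next
  case (Suc k)
  then show ?case by (simp only: power_Suc chi_mult)
qed

lemma geometric_chi_nonneg: "0 \<le> (\<Sum>i\<le>k. chi p ^ i)"
proof -
  consider "chi p = 1" | "chi p = 0" | "chi p = -1" unfolding chi_def by argo
  then show ?thesis
  proof cases
    case 3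
    have "(\<Sum>i\<le>k. (-1::real) ^ i) = (if even k then 1 else 0)" by (induction k) auto
    with 3 show ?thesis by simp
  qed (auto intro: sum_nonneg)
qed

text \<open>A divisor of \<open>p ^ k * m\<close> is \<open>p ^ i * e\<close> in exactly one way,
  since \<open>i\<close> can be read off as its multiplicity at \<open>p\<close>. For multiplicative
  \<open>f\<close> the double sum then splits into a product.\<close>

lemma sum_divisors_prime_power_mult:
  fixes f :: "nat \<Rightarrow> 'a::comm_monoid_add"
  assumes p: "prime p" and m: "\<not> p dvd m"
  shows "(\<Sum>d | d dvd p ^ k * m. f d) = (\<Sum>i\<le>k. \<Sum>e | e dvd m. f (p ^ i * e))"
proof -
  have p1: "p > 1" using p prime_gt_1_nat by blast
  have m0: "m > 0" using m by (cases m) auto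
  let ?g = "\<lambda>(i::nat, e). p ^ i * e"
  let ?A = "{..k} \<times> {e. e dvd m}"
  have mult: "multiplicity p (p ^ i * e) = i" if "e dvd m" for i e
    using that m p1 m0 by (intro multiplicity_eqI) (auto simp: dvd_def)
  have inj: "inj_on ?g ?A"
  proof (rule inj_onI, clarsimp)
    fix i e i' e' assume h: "e dvd m" "e' dvd m" "p ^ i * e = p ^ i' * e'"
    then have "i = i'" using mult by metis
    with h p1 show "i = i' \<and> e = e'" by auto
  qed
  have img: "?g ` ?A = {d. d dvd p ^ k * m}"
  proof (intro equalityI subsetI)
    fix d assume "d \<in> {d. d dvd p ^ k * m}"
    then obtain a b where ab: "d = a * b" "a dvd p ^ k" "b dvd m"
      using division_decomp[of d "p^k" m] by blast
    then obtain i where "i \<le> k" "a = p ^ i" using p divides_primepow_nat by blast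
    with ab show "d \<in> ?g ` ?A" by force
  next
    fix d assume "d \<in> ?g ` ?A"
    then show "d \<in> {d. d dvd p ^ k * m}" by (auto intro!: mult_dvd_mono le_imp_power_dvd)
  qed
  show ?thesis
    unfolding img[symmetric] sum.reindex[OF inj] by (simp add: sum.cartesian_product case_prod_unfold)
qed

text \<open>Strip off the full power of one prime \<open>p\<close>: the divisor sum is
  multiplicative, and its factor at \<open>p\<close> is a partial geometric sum of ratio 1, 0 or -1,
  never negative.\<close>

lemma sum_chi_divisors_nonneg: "n > 0 \<Longrightarrow> 0 \<le> (\<Sum>d | d dvd n. chi d)"
proof (induction n rule: less_induct)
  case (less n)
  show ?case
  proof (cases "n = 1")
    case False
    then obtain p where p: "prime p" "p dvd n" using prime_factor_nat by blast
    have p1: "p > 1" using p prime_gt_1_nat by blast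
    obtain m where m: "n = p ^ multiplicity p n * m" "\<not> p dvd m"
      using multiplicity_decompose'[of n p] less.prems p1 by (metis not_prime_unit p(1) less_numeral_extra(3))
    have "multiplicity p n > 0" using p m by (metis gr0I mult_1 power_0)
    then have "p ^ multiplicity p n > 1" using p1 by (metis one_less_power)
    moreover have "m > 0" using m less.prems by (cases m) auto
    ultimately have "m < n" using m(1) by (metis mult.commute mult_1 mult_less_cancel1 nat_mult_1_right)
    then have IH: "0 \<le> (\<Sum>d | d dvd m. chi d)" using less.IH \<open>m > 0\<close> by blast
    have "(\<Sum>d | d dvd n. chi d) = (\<Sum>i\<le>multiplicity p n. chi p ^ i) * (\<Sum>d | d dvd m. chi d)"
      by (subst m(1), subst sum_divisors_prime_power_mult[OF p(1) m(2)])
        (simp add: chi_mult chi_power sum_product)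
    with IH show ?thesis using geometric_chi_nonneg by simp
  qed (simp add: chi_def)
qed

text \<open>The signs run +, -, 0. The subtracted term strengthens the induction: it is the slack
  left by the last minus sign, and it pays for the next plus sign because \<open>f\<close>
  decreases.\<close>

lemma sum_chi_antimono_le:
  fixes f :: "nat \<Rightarrow> real"
  assumes anti: "\<And>d. d \<ge> 1 \<Longrightarrow> f (Suc d) \<le> f d" and nonneg: "\<And>d. 0 \<le> f d"
  shows "(\<Sum>d=1..Suc N. chi d * f d) \<le> f 1 - (if Suc N mod 3 = 1 then 0 else f (Suc N))"
proof (induction N)
  case (Suc N)
  have "f (Suc (Suc N)) \<le> f (Suc N)" using anti by simp
  moreover have "Suc N mod 3 = 0 \<and> Suc (Suc N) mod 3 = 1 \<or> Suc N mod 3 = 1 \<and> Suc (Suc N) mod 3 = 2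
    \<or> Suc N mod 3 = 2 \<and> Suc (Suc N) mod 3 = 0" by presburger
  ultimately show ?case
    using Suc nonneg[of "Suc N"] by (elim disjE conjE) (simp_all add: chi_def)
qed (simp add: chi_def)

lemma sum_sum_chi_divisors_le: "(\<Sum>n=1..N. (\<Sum>d | d dvd n. chi d) / real n) \<le> harm N"
proof (cases N)
  case (Suc M)
  have le: "b \<le> N" if "0 < k" "b * k \<le> N" for b k :: nat
    using that by (metis One_nat_def Suc_leI le_trans mult.right_neutral mult_le_mono2)
  define f where "f d = (harm (N div d) / real d :: real)" for d
  have "(\<Sum>n=1..N. (\<Sum>d | d dvd n. chi d) / real n)
      = (\<Sum>(n, d) \<in> (SIGMA n:{1..N}. {d. d dvd n}). chi d / real n)"
    by (simp add: sum.Sigma sum_divide_distrib)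
  \<comment> \<open>Write \<open>n = d * e\<close>, so that for fixed \<open>d\<close> the cofactor
    \<open>e\<close> ranges over a full interval and produces a harmonic number.\<close>
  also have "\<dots> = (\<Sum>(d, e) \<in> (SIGMA d:{1..N}. {1..N div d}). chi d / (real d * real e))"
    by (rule sum.reindex_bij_witness[of _ "\<lambda>(d, e). (d * e, d)" "\<lambda>(n, d). (d, n div d)"])
      (auto simp: less_eq_div_iff_mult_less_eq mult.commute Suc_le_eq
        elim!: dvdE intro: le)
  also have "\<dots> = (\<Sum>d=1..N. chi d * f d)"
    by (simp add: f_def harm_def sum.Sigma[symmetric] sum_distrib_left sum_divide_distrib field_simps)
  also have "\<dots> \<le> f 1 - (if Suc M mod 3 = 1 then 0 else f (Suc M))"
    unfolding Suc
  proof (rule sum_chi_antimono_le)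
    fix d :: nat assume "d \<ge> 1"
    then show "f (Suc d) \<le> f d" unfolding f_def
      by (intro frac_le harm_nonneg harm_mono div_le_mono2) auto
  qed (simp add: f_def harm_nonneg)
  also have "\<dots> \<le> f 1" by (simp add: f_def harm_nonneg)
  finally show ?thesis by (simp add: f_def)
qed (simp add: harm_def)

section \<open>Harmonic sums over numbers with all prime factors 1 mod 3, and the sieve\<close>

definition split_nats :: "nat set" where
  "split_nats = {n. n > 0 \<and> (\<forall>p. prime p \<longrightarrow> p dvd n \<longrightarrow> p mod 3 = 1)}"

lemma split_nats_mod_3: "n \<in> split_nats \<Longrightarrow> n mod 3 = 1"
proof (induction n rule: prime_divisors_induct)
  case (factor p x)
  then have "x \<in> split_nats" "p mod 3 = 1" unfolding split_nats_def by auto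
  with factor have "(p mod 3) * (x mod 3) mod 3 = 1" by simp
  then show ?case by (simp add: mod_mult_eq)
qed (auto simp: split_nats_def)

lemma split_nats_mult: "a \<in> split_nats \<Longrightarrow> b \<in> split_nats \<Longrightarrow> a * b \<in> split_nats"
  unfolding split_nats_def by (auto simp: prime_dvd_mult_iff)

lemma split_nats_dvd: "a \<in> split_nats \<Longrightarrow> d dvd a \<Longrightarrow> d \<in> split_nats"
  unfolding split_nats_def by (auto intro: dvd_trans dvd_pos_nat)

text \<open>Expanding the square gives pairs \<open>(d, e)\<close>. Each is recorded as its product
  together with the divisor \<open>d\<close>, so a product occurs at most once per divisor. All
  these divisors are 1 mod 3, so their number is the divisor sum of \<open>chi\<close>.\<close>

lemma sum_split_nats_squared_le: "(\<Sum>b\<in>split_nats \<inter> {1..N}. 1 / real b)\<^sup>2 \<le> harm (N\<^sup>2)"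
proof -
  let ?B = "split_nats \<inter> {1..N}" and ?M = "split_nats \<inter> {1..N\<^sup>2}"
  let ?h = "\<lambda>(d, e). (d * e, d :: nat)"
  have inj: "inj_on ?h (?B \<times> ?B)" by (auto simp: inj_on_def)
  have sub: "?h ` (?B \<times> ?B) \<subseteq> (SIGMA n:?M. {d. d dvd n})"
    by (auto intro: split_nats_mult simp: power2_eq_square mult_le_mono Suc_le_eq)
  have chi_split_nats: "chi d = 1" if "n \<in> split_nats" "d dvd n" for n d
    using split_nats_mod_3[OF split_nats_dvd[OF that]] by (simp add: chi_def)
  have fin: "finite (SIGMA n:?M. {d. d dvd n})" by (auto intro!: finite_SigmaI)
  have "(\<Sum>b\<in>?B. 1 / real b)\<^sup>2 = (\<Sum>(n, d)\<in>?h ` (?B \<times> ?B). 1 / real n)"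
    by (subst sum.reindex[OF inj]) (simp add: power2_eq_square sum_product sum.cartesian_product case_prod_unfold)
  also have "\<dots> \<le> (\<Sum>(n, d)\<in>(SIGMA n:?M. {d. d dvd n}). 1 / real n)"
    by (intro sum_mono2 fin sub) auto
  also have "\<dots> = (\<Sum>(n, d)\<in>(SIGMA n:?M. {d. d dvd n}). chi d / real n)"
    by (rule sum.cong) (auto simp: chi_split_nats)
  also have "\<dots> = (\<Sum>n\<in>?M. (\<Sum>d | d dvd n. chi d) / real n)"
    by (subst sum.Sigma[symmetric]) (auto simp: sum_divide_distrib)
  also have "\<dots> \<le> (\<Sum>n=1..N\<^sup>2. (\<Sum>d | d dvd n. chi d) / real n)"
    by (intro sum_mono2 divide_nonneg_nonneg sum_chi_divisors_nonneg) auto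
  also have "\<dots> \<le> harm (N\<^sup>2)" by (rule sum_sum_chi_divisors_le)
  finally show ?thesis .
qed

text \<open>If \<open>n = q * m\<close> survives the earlier primes, so does \<open>m\<close>. Hence
  the survivors divisible by a new prime \<open>q\<close> carry at most the fraction
  \<open>1 / q\<close> of the sum; this is only an inequality because \<open>q * m\<close> may
  exceed \<open>N\<close>.\<close>

lemma harm_sieve:
  fixes P :: "nat set"
  assumes "finite P" "\<And>p. p \<in> P \<Longrightarrow> prime p"
  shows "(\<Prod>p\<in>P. 1 - 1 / real p) * harm N \<le> (\<Sum>n | n \<in> {1..N} \<and> (\<forall>p\<in>P. \<not> p dvd n). 1 / real n)"
  using assms
proof (induction P rule: finite_induct)
  case empty
  then show ?case by (simp add: harm_def inverse_eq_divide flip: atLeastAtMost_iff)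
next
  case (insert q P)
  define A where "A = {n. n \<in> {1..N} \<and> (\<forall>p\<in>P. \<not> p dvd n)}"
  have finA: "finite A" unfolding A_def by simp
  have q: "q > 1" using insert prime_gt_1_nat by blast
  have IH: "(\<Prod>p\<in>P. 1 - 1 / real p) * harm N \<le> (\<Sum>n\<in>A. 1 / real n)"
    using insert unfolding A_def by auto
  have sub: "{n\<in>A. q dvd n} \<subseteq> (\<lambda>m. q * m) ` A"
  proof
    fix n assume "n \<in> {n\<in>A. q dvd n}"
    then obtain m where m: "n = q * m" "n \<in> A" by auto
    then have "m \<le> n" "n \<le> N" using q by (simp_all add: A_def)
    then have "m \<le> N" by (rule le_trans)
    with m have "m \<in> A" by (auto simp: A_def Suc_le_eq)
    with m show "n \<in> (\<lambda>m. q * m) ` A" by blast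
  qed
  have "(\<Sum>n | n \<in> A \<and> q dvd n. 1 / real n) \<le> (\<Sum>n\<in>(\<lambda>m. q * m) ` A. 1 / real n)"
    by (intro sum_mono2 sub finite_imageI finA) auto
  also have "\<dots> = (\<Sum>n\<in>A. 1 / real n) / real q"
    using q by (subst sum.reindex) (auto simp: inj_on_def sum_divide_distrib field_simps)
  finally have le: "(\<Sum>n | n \<in> A \<and> q dvd n. 1 / real n) \<le> (\<Sum>n\<in>A. 1 / real n) / real q" .
  have "(\<Prod>p\<in>insert q P. 1 - 1 / real p) * harm N = (1 - 1 / real q) * ((\<Prod>p\<in>P. 1 - 1 / real p) * harm N)"
    using insert by simp
  also have "\<dots> \<le> (1 - 1 / real q) * (\<Sum>n\<in>A. 1 / real n)"
    using IH q by (intro mult_left_mono) auto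
  also have "\<dots> \<le> (\<Sum>n\<in>A. 1 / real n) - (\<Sum>n | n \<in> A \<and> q dvd n. 1 / real n)"
    using le by (simp add: algebra_simps)
  also have "\<dots> = (\<Sum>n\<in>A - {n\<in>A. q dvd n}. 1 / real n)"
    using finA by (subst sum_diff) auto
  also have "A - {n\<in>A. q dvd n} = {n. n \<in> {1..N} \<and> (\<forall>p\<in>insert q P. \<not> p dvd n)}"
    unfolding A_def by auto
  finally show ?case .
qed

lemma prod_primes_not_1_mod_3_le:
  assumes "N > 0"
  shows "(\<Prod>p | prime p \<and> p \<le> N \<and> p mod 3 \<noteq> 1. 1 - 1 / real p) \<le> sqrt (3 / harm N)"
proof -
  let ?P = "{p. prime p \<and> p \<le> N \<and> p mod 3 \<noteq> 1}"
  let ?D = "\<Prod>p\<in>?P. 1 - 1 / real p"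
  have h1: "(1::real) \<le> harm N" using harm_mono[of 1 N] assms by (simp add: harm_def)
  have D0: "?D \<ge> 0" by (intro prod_nonneg) (auto dest: prime_gt_0_nat simp: field_simps)
  have "?D * harm N \<le> (\<Sum>n | n \<in> {1..N} \<and> (\<forall>p\<in>?P. \<not> p dvd n). 1 / real n)"
    by (rule harm_sieve) auto
  \<comment> \<open>A prime factor of some \<open>n\<close> in \<open>{1..N}\<close> is itself at
    most \<open>N\<close>, so avoiding \<open>?P\<close> leaves only primes that are 1 mod
    3.\<close>
  also have "{n. n \<in> {1..N} \<and> (\<forall>p\<in>?P. \<not> p dvd n)} = split_nats \<inter> {1..N}"
    unfolding split_nats_def by (auto, meson dvd_imp_le le_trans Suc_le_eq)
  finally have "(?D * harm N)\<^sup>2 \<le> (\<Sum>b\<in>split_nats \<inter> {1..N}. 1 / real b)\<^sup>2"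
    using D0 h1 by (intro power_mono) auto
  also have "\<dots> \<le> harm (N\<^sup>2)" by (rule sum_split_nats_squared_le)
  \<comment> \<open>\<open>harm n - ln n\<close> decreases from its value 1 at \<open>n = 1\<close>.
    Squaring \<open>N\<close> only doubles the logarithm, which leads to the factor 3.\<close>
  also have "\<dots> \<le> 1 + ln (real (N\<^sup>2))"
    using euler_mascheroni_sequence_decreasing[of 1 "N\<^sup>2"] assms by (simp add: harm_def)
  also have "\<dots> = 1 + 2 * ln (real N)" using assms by (simp add: ln_realpow)
  also have "\<dots> \<le> 1 + 2 * harm N" using ln_le_harm[of N] assms
    by (smt (verit) ln_le_cancel_iff of_nat_0_less_iff)
  also have "\<dots> \<le> 3 * harm N" using h1 by simp
  finally have "?D\<^sup>2 * harm N * harm N \<le> 3 * harm N" by (simp add: power2_eq_square mult_ac)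
  then have "?D\<^sup>2 * harm N \<le> 3" by (rule mult_right_le_imp_le) (use h1 in linarith)
  then have "?D\<^sup>2 \<le> 3 / harm N" using h1 by (subst pos_le_divide_eq) linarith+
  then show ?thesis by (rule real_le_rsqrt)
qed

section \<open>Prime factors of \<open>2 * c + 1\<close> for coordinates \<open>c\<close> of fair
  games\<close>

lemma prime_dvd_square_plus_self_plus_1:
  fixes p t :: nat
  assumes p: "prime p" and dvd: "p dvd t\<^sup>2 + t + 1"
  shows "p mod 3 \<noteq> 2"
proof
  assume p2: "p mod 3 = 2"
  have X: "[t\<^sup>2 + t + 1 = 0] (mod p)" using dvd by (simp add: cong_0_iff)
  have "t ^ 3 + (t\<^sup>2 + t + 1) = t * (t\<^sup>2 + t + 1) + 1"
    by (simp add: algebra_simps power2_eq_square power3_eq_cube)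
  moreover have "[t ^ 3 + (t\<^sup>2 + t + 1) = t ^ 3 + 0] (mod p)" "[t * (t\<^sup>2 + t + 1) + 1 = t * 0 + 1] (mod p)"
    using X by (intro cong_add cong_mult cong_refl; simp)+
  ultimately have t3: "[t ^ 3 = 1] (mod p)"
    by (metis add.right_neutral add_0 cong_sym cong_trans mult_0_right)
  have "\<not> p dvd t"
  proof
    assume "p dvd t"
    then have "p dvd t\<^sup>2 + t" by (simp add: power2_eq_square)
    then have "p dvd 1" using dvd by (simp only: dvd_add_right_iff)
    then show False using p by (simp add: prime_gt_1_nat)
  qed
  then have fermat: "[t ^ (p - 1) = 1] (mod p)" by (rule fermat_theorem[OF p])
  define k where "k = p div 3"
  \<comment> \<open>As \<open>p - 1\<close> is 1 mod 3, \<open>t ^ 3 = 1\<close> reduces Fermat's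
    theorem to \<open>t = 1\<close> mod \<open>p\<close>. Then \<open>p\<close> divides 3, which
    contradicts \<open>p mod 3 = 2\<close>.\<close>
  have pk: "p - 1 = 3 * k + 1" using p2 unfolding k_def by presburger
  have "[(t ^ 3) ^ k * t = 1 ^ k * t] (mod p)" using t3 by (intro cong_mult cong_pow) auto
  moreover have "(t ^ 3) ^ k * t = t ^ (p - 1)" unfolding pk by (simp add: power_add power_mult)
  ultimately have "[t ^ (p - 1) = t] (mod p)" by simp
  with fermat have "[t = 1] (mod p)" by (metis cong_sym cong_trans)
  then have "[t\<^sup>2 + t + 1 = 1\<^sup>2 + 1 + 1] (mod p)" by (intro cong_add cong_pow) auto
  from cong_dvd_iff[OF this] have "p dvd 3" using dvd by (simp add: numeral_3_eq_3)
  moreover from this have "p \<le> 3" by (rule dvd_imp_le) simp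
  then have "p = 2" using p2 by presburger
  ultimately show False by simp
qed

lemma fair_game3_prime_dvd:
  assumes "fair_game3 x1 x2 x3" "prime p" "int p dvd 2 * x3 + 1"
  shows "p mod 3 \<noteq> 2"
proof -
  \<comment> \<open>The game is symmetric in its first two coordinates; ordering them makes
    \<open>x1 - x2 + x3\<close> a natural number.\<close>
  have main: ?thesis if g: "fair_game3 x1 x2 x3" "x2 \<le> x1" for x1 x2
  proof (rule prime_dvd_square_plus_self_plus_1[OF assms(2)])
    define t where "t = nat (x1 - x2 + x3)"
    have t: "int t = x1 - x2 + x3" using g unfolding t_def fair_game3_def by simp
    have "(x1 - x2 + x3)\<^sup>2 + (x1 - x2 + x3) + 1 = (2 * x3 + 1) * (2 * x1 + 1)"
      using g unfolding fair_game3_def by (simp add: algebra_simps power2_eq_square)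
    then have "int (t\<^sup>2 + t + 1) = (2 * x3 + 1) * (2 * x1 + 1)" using t by simp
    then have "int p dvd int (t\<^sup>2 + t + 1)" using assms(3) by simp
    then show "p dvd t\<^sup>2 + t + 1" by (simp only: int_dvd_int_iff)
  qed
  have "fair_game3 x2 x1 x3" using assms(1) unfolding fair_game3_def by (simp add: algebra_simps)
  with assms(1) main[of x1 x2] main[of x2 x1] show ?thesis by linarith
qed

lemma C3_prime_dvd:
  assumes "c \<in> C3" "prime p" "int p dvd 2 * c + 1"
  shows "p mod 3 \<noteq> 2"
proof -
  obtain x1 x2 x3 where x: "fair_game3 x1 x2 x3" "c \<in> {x1, x2, x3}"
    using assms(1) unfolding C3_def by auto
  moreover have "fair_game3 x3 x2 x1" "fair_game3 x1 x3 x2"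
    using x(1) unfolding fair_game3_def by (simp_all add: algebra_simps)
  ultimately show ?thesis using assms(2,3) fair_game3_prime_dvd by auto
qed

lemma C3_nonneg: "c \<in> C3 \<Longrightarrow> 0 \<le> c"
  unfolding C3_def fair_game3_def by auto

section \<open>Counting residues and passing to the density\<close>

lemma card_coprime_le:
  fixes Q :: nat
  assumes "Q > 1" "odd Q"
  shows "card {c. c \<le> k \<and> coprime (2 * c + 1) Q} \<le> (k div Q + 1) * totient Q"
proof -
  let ?A = "{c. c \<le> k \<and> coprime (2 * c + 1) Q}"
  \<comment> \<open>As 2 is invertible modulo the odd \<open>Q\<close>, the residue of
    \<open>2 * c + 1\<close> determines \<open>c\<close> within its block of length
    \<open>Q\<close>.\<close>
  let ?h = "\<lambda>c. (c div Q, (2 * c + 1) mod Q)"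
  have "inj_on ?h ?A"
  proof (rule inj_onI, clarify)
    fix a b assume h: "a div Q = b div Q" "(2 * a + 1) mod Q = (2 * b + 1) mod Q"
    then have "[2 * a + 1 = 2 * b + 1] (mod Q)" by (simp add: cong_def)
    then have "[2 * a = 2 * b] (mod Q)" by (simp only: cong_add_rcancel_nat)
    moreover have "coprime 2 Q" using assms by simp
    ultimately have "[a = b] (mod Q)" by (simp add: cong_mult_lcancel_nat)
    with h show "a = b" by (metis cong_def div_mult_mod_eq)
  qed
  \<comment> \<open>\<open>totatives Q\<close> omits 0; the residue 0 is coprime to \<open>Q\<close>
    only for \<open>Q = 1\<close>.\<close>
  moreover have "?h ` ?A \<subseteq> {..k div Q} \<times> totatives Q"
    using assms by (auto simp: totatives_def div_le_mono coprime_commute intro!: Nat.gr0I) 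
  ultimately have "card ?A \<le> card ({..k div Q} \<times> totatives Q)"
    by (rule card_inj_on_le) simp
  then show ?thesis by (simp add: totient_def)
qed

text \<open>Primes that are 2 mod 3 are those inert in the Eisenstein integers. The prime 2 is left
  out to keep the modulus odd, as \<open>card_coprime_le\<close> requires.\<close>

definition inert_primorial :: "nat \<Rightarrow> nat" where
  "inert_primorial N = \<Prod>{p. prime p \<and> odd p \<and> p mod 3 = 2 \<and> p \<le> N}"

lemma prime_dvd_inert_primorialD: "prime p \<Longrightarrow> p dvd inert_primorial N \<Longrightarrow> odd p \<and> p mod 3 = 2"
  unfolding inert_primorial_def by (subst (asm) prime_dvd_prod_iff) (auto dest: primes_dvd_imp_eq)

lemma totient_inert_primorial:
  assumes "N \<ge> 3"
  shows "totient (inert_primorial N) / inert_primorial N \<le> 3 * sqrt (3 / harm N)"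
proof -
  let ?P = "{p. prime p \<and> odd p \<and> p mod 3 = 2 \<and> p \<le> N}"
  let ?R = "{p. prime p \<and> p \<le> N \<and> p mod 3 \<noteq> 1}"
  have "totient (inert_primorial N) = (\<Prod>p\<in>?P. totient p)"
    unfolding inert_primorial_def by (subst totient_prod_coprime) (auto simp: pairwise_def intro: primes_coprime)
  then have "real (totient (inert_primorial N)) / real (inert_primorial N) = (\<Prod>p\<in>?P. real (totient p)) / (\<Prod>p\<in>?P. real p)"
    unfolding inert_primorial_def by simp
  also have "\<dots> = (\<Prod>p\<in>?P. real (totient p) / real p)" by (rule prod_dividef[symmetric])
  also have "\<dots> = (\<Prod>p\<in>?P. 1 - 1 / real p)"
    by (rule prod.cong) (auto simp: totient_prime field_simps of_nat_diff dest: prime_gt_0_nat)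
  finally have 1: "real (totient (inert_primorial N)) / real (inert_primorial N) = (\<Prod>p\<in>?P. 1 - 1 / real p)" .
  \<comment> \<open>The factors 2 and 3 account for the constant \<open>1 / ((1 - 1/2) * (1 - 1/3)) = 3\<close>.\<close>
  have "?R = insert 2 (insert 3 ?P)"
  proof (intro equalityI subsetI)
    fix p assume p: "p \<in> ?R"
    show "p \<in> insert 2 (insert 3 ?P)"
    proof (cases "3 dvd p \<or> 2 dvd p")
      case True then show ?thesis using p by (auto dest: primes_dvd_imp_eq[rotated])
    next
      case False then have "p mod 3 = 2" using p by auto presburger
      with False p show ?thesis by auto
    qed
  qed (use assms in auto)
  then have "(\<Prod>p\<in>?R. 1 - 1 / real p) = 1 / 3 * (\<Prod>p\<in>?P. 1 - 1 / real p)" by simp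
  with 1 prod_primes_not_1_mod_3_le[of N] assms show ?thesis by simp
qed

lemma totient_inert_primorial_tendsto_0: "(\<lambda>N. totient (inert_primorial N) / inert_primorial N) \<longlonglongrightarrow> 0"
proof (rule tendsto_sandwich[where f = "\<lambda>_. 0" and h = "\<lambda>N. 3 * sqrt (3 / harm N)"])
  have "(\<lambda>N. 3 / harm N :: real) \<longlonglongrightarrow> 0"
    by (intro real_tendsto_divide_at_top[OF tendsto_const] harm_at_top)
  from tendsto_mult[OF tendsto_const tendsto_real_sqrt[OF this], of 3]
  show "(\<lambda>N. 3 * sqrt (3 / harm N)) \<longlonglongrightarrow> 0" by simp
  show "\<forall>\<^sub>F N in sequentially. totient (inert_primorial N) / inert_primorial N \<le> 3 * sqrt (3 / harm N)"
    using eventually_ge_at_top[of 3] by eventually_elim (rule totient_inert_primorial)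
qed auto

lemma card_C3_le:
  assumes "N \<ge> 5"
  shows "card {c \<in> C3. c \<le> int k} \<le> (k div inert_primorial N + 1) * totient (inert_primorial N)"
proof -
  have "odd (inert_primorial N)" using prime_dvd_inert_primorialD[of 2 N] by auto
  \<comment> \<open>5 is the least odd prime that is 2 mod 3, so \<open>N \<ge> 5\<close> keeps the
    product from being empty.\<close>
  moreover have "5 dvd inert_primorial N" unfolding inert_primorial_def using assms by (intro dvd_prodI) auto
  moreover have "inert_primorial N \<noteq> 0" unfolding inert_primorial_def by auto
  ultimately have Q: "inert_primorial N > 1" "odd (inert_primorial N)" by (auto dest!: dvd_imp_le)
  have "{c \<in> C3. c \<le> int k} \<subseteq> int ` {c. c \<le> k \<and> coprime (2 * c + 1) (inert_primorial N)}"
  proof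
    fix c assume c: "c \<in> {c \<in> C3. c \<le> int k}"
    then obtain n where n: "c = int n" using C3_nonneg nonneg_int_cases by blast
    have "coprime (2 * n + 1) (inert_primorial N)"
    proof (rule ccontr)
      assume "\<not> ?thesis"
      then obtain p where p: "prime p" "p dvd 2 * n + 1" "p dvd inert_primorial N"
        by (meson coprime_iff_gcd_eq_1 gcd_nat.boundedE prime_factor_nat)
      have "2 * c + 1 = int (2 * n + 1)" by (simp add: n)
      with p(2) have "int p dvd 2 * c + 1" by (simp only: int_dvd_int_iff)
      with c C3_prime_dvd[of c p] p prime_dvd_inert_primorialD[of p N] show False by auto
    qed
    then show "c \<in> int ` {c. c \<le> k \<and> coprime (2 * c + 1) (inert_primorial N)}" using c n by auto
  qed
  then have "card {c \<in> C3. c \<le> int k} \<le> card (int ` {c. c \<le> k \<and> coprime (2 * c + 1) (inert_primorial N)})"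
    by (intro card_mono finite_imageI) auto
  also have "\<dots> \<le> card {c. c \<le> k \<and> coprime (2 * c + 1) (inert_primorial N)}" by (intro card_image_le) auto
  finally show ?thesis using card_coprime_le[OF Q] le_trans by blast
qed

theorem theorem5p6:
  shows "(\<lambda>k::nat. real (card {c \<in> C3. c \<le> int k}) / real k) \<longlonglongrightarrow> 0"
proof (rule LIMSEQ_I)
  fix e :: real assume e: "e > 0"
  have "\<forall>\<^sub>F N in sequentially. N \<ge> 5 \<and> totient (inert_primorial N) / inert_primorial N < e / 2"
    using order_tendstoD(2)[OF totient_inert_primorial_tendsto_0, of "e / 2"] e
    by (intro eventually_conj eventually_ge_at_top) simp
  then obtain N where N: "N \<ge> 5" "totient (inert_primorial N) / inert_primorial N < e / 2"
    unfolding eventually_sequentially by blast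
  let ?t = "real (totient (inert_primorial N))"
  \<comment> \<open>With \<open>N\<close> fixed, full blocks contribute density below
    \<open>e / 2\<close>; the bound on \<open>k\<close> makes the extra block, at most
    \<open>?t\<close> elements, cost at most \<open>k * e / 2\<close>.\<close>
  have "norm (real (card {c \<in> C3. c \<le> int k}) / real k - 0) < e" if k: "k \<ge> nat \<lceil>2 * ?t / e\<rceil> + 1" for k
  proof -
    have k2: "2 * ?t / e \<le> real k" "k > 0" using k by linarith+
    have "real (card {c \<in> C3. c \<le> int k}) \<le> real ((k div inert_primorial N + 1) * totient (inert_primorial N))"
      using card_C3_le[OF N(1)] of_nat_le_iff by blast
    also have "\<dots> \<le> (real k / real (inert_primorial N) + 1) * ?t"
      by (simp only: of_nat_mult of_nat_add of_nat_1)
        (intro mult_right_mono add_right_mono of_nat_div_le_of_nat of_nat_0_le_iff)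
    also have "\<dots> = real k * (?t / real (inert_primorial N)) + ?t" by (simp add: algebra_simps)
    also have "\<dots> < real k * (e / 2) + real k * (e / 2)"
      using k2 N(2) e by (intro add_less_le_mono mult_strict_left_mono) (auto simp: field_simps)
    finally show ?thesis using k2 by (simp add: field_simps)
  qed
  then show "\<exists>no. \<forall>k\<ge>no. norm (real (card {c \<in> C3. c \<le> int k}) / real k - 0) < e" by blast
qed

end
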